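(* Let $n\ge 1$ be an integer. For all $m=1,\dots,n$, let $E_m$ be a real vector space and $S_m\colon E_m\to\mathbb{R}$ be sublinear. Let $Z$ be a nonempty set and, for all $m=1,\dots,n$, let $j_m\colon Z\to E_m$ be a map. Suppose that for all $z_1,z_2\in Z$ there exists $z\in Z$ such that $$\sum_{m=1}^n S_m\big(j_m(z)-\tfrac12 j_m(z_1)-\tfrac12 j_m(z_2)\big)\le 0.$$ Then, for all $m=1,\dots,n$, there exists a linear map $L_m\colon E_m\to\mathbb{R}$ such that $L_m\le S_m$ on $E_m$ for each $m$ and $$\inf_Z\sum_{m=1}^n\big[L_m\circ j_m\big]=\inf_Z\sum_{m=1}^n\big[S_m\circ j_m\big].$$
   Context: All vector spaces are real. A function $S\colon E\to\mathbb{R}$ on a vector space is sublinear if $S(0)=0$, $S(\lambda x)=\lambda S(x)$ for all $x\in E$ and $\lambda>0$, and $S(x+y)\le S(x)+S(y)$ for all $x,y\in E$. Infima are taken in $[-\infty,\infty[$, i.e. the value $-\infty$ is allowed, and $\inf_Z g$ denotes $\inf_{z\in Z}g(z)$. *)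

theory Defs
  imports "HOL-Analysis.Analysis"
begin

(* A finite family of vector spaces E 1, ..., E n of different sizes is rendered as a family of
   linear subspaces of one ambient real vector space; nothing is lost, since any family of vector
   spaces embeds into its direct sum. A map with domain E m is a total HOL function on the ambient
   type whose values outside E m are irrelevant, so both notions below are relative to the
   subspace V. *)

definition sublinear_on :: "'a::real_vector set \<Rightarrow> ('a \<Rightarrow> real) \<Rightarrow> bool" where
  "sublinear_on V S \<longleftrightarrow>
     S 0 = 0 \<and>
     (\<forall>x\<in>V. \<forall>c>0. S (c *\<^sub>R x) = c * S x) \<and>
     (\<forall>x\<in>V. \<forall>y\<in>V. S (x + y) \<le> S x + S y)"

definition linear_functional_on :: "'a::real_vector set \<Rightarrow> ('a \<Rightarrow> real) \<Rightarrow> bool" where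
  "linear_functional_on V L \<longleftrightarrow>
     (\<forall>x\<in>V. \<forall>y\<in>V. L (x + y) = L x + L y) \<and>
     (\<forall>x\<in>V. \<forall>c. L (c *\<^sub>R x) = c * L x)"

end

theory Submission
  imports Defs "HOL-Library.Function_Algebras"
begin

text \<open>
  The finite family of spaces is only apparent. On the direct sum \<open>V\<close> of the \<open>E m\<close> the functional
  \<open>x \<mapsto> \<Sum>m. S m (x m)\<close> is sublinear, the maps \<open>j m\<close> combine into one map into \<open>V\<close>, and a linear
  functional on \<open>V\<close> that it dominates splits into one linear functional on each \<open>E m\<close>, dominated by
  \<open>S m\<close> because every \<open>S k\<close> vanishes at \<open>0\<close>. So it suffices to treat one sublinear functional \<open>S\<close> and a
  nonempty set \<open>A \<subseteq> V\<close>, the image of \<open>Z\<close> (lemma \<open>hahn_banach_lagrange\<close>).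

  If \<open>S\<close> is unbounded below on \<open>A\<close>, any linear \<open>L \<le> S\<close> will do. Otherwise let \<open>b\<close> be the infimum of \<open>S\<close>
  on \<open>A\<close> and let \<open>T x\<close> be the infimum of \<open>S (x + t a) - t b\<close> over all \<open>a \<in> A\<close> and real \<open>t \<ge> 0\<close>.
  Then \<open>T \<le> S\<close> (take \<open>t = 0\<close>) and \<open>T (- a) \<le> - b\<close> (take \<open>t = 1\<close>), so every linear \<open>L \<le> T\<close> satisfies
  \<open>L a \<ge> b\<close> on \<open>A\<close>. That \<open>T\<close> is sublinear is where the hypothesis on midpoints enters: adding a term
  with \<open>(p, s)\<close> to one with \<open>(q, t)\<close> calls for a point of \<open>A\<close> that serves as the convex combination of \<open>p\<close>
  and \<open>q\<close> with weights proportional to \<open>s\<close> and \<open>t\<close>. Repeated halving produces such points up to an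
  arbitrarily small error, which an infimum does not notice.

  The same construction also gives the Hahn--Banach theorem: below \<open>S\<close> there is a minimal sublinear
  functional \<open>T\<close> by Zorn's lemma, and applying the construction to \<open>T\<close> with the singleton \<open>A = {y}\<close> and
  \<open>b = T y\<close> shows by minimality that \<open>T (- y) \<le> - T y\<close> for every \<open>y\<close>, hence that \<open>T\<close> is linear.
\<close>

section \<open>Sublinear functionals on a subspace\<close>

lemma sublinear_on_scale_nonneg:
  assumes "sublinear_on V S" "x \<in> V" "c \<ge> 0"
  shows "S (c *\<^sub>R x) = c * S x"
  using assms by (cases "c = 0") (auto simp: sublinear_on_def)

lemma sublinear_on_minus_le:
  assumes "sublinear_on V S" "subspace V" "x \<in> V"
  shows "- S (- x) \<le> S x"
proof -
  have "S (x + (- x)) \<le> S x + S (- x)"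
    using assms by (metis sublinear_on_def subspace_neg)
  then show ?thesis
    using assms(1) by (simp add: sublinear_on_def)
qed

lemma sublinear_on_cong:
  assumes "subspace V" "\<And>x. x \<in> V \<Longrightarrow> S x = T x" "sublinear_on V S"
  shows "sublinear_on V T"
proof -
  have "T 0 = 0"
    using assms(2)[OF subspace_0[OF assms(1)]] assms(3) by (simp add: sublinear_on_def)
  moreover have "T (c *\<^sub>R x) = c * T x" if "x \<in> V" "c > 0" for x c
    using assms(2)[of x] assms(2)[of "c *\<^sub>R x"] subspace_scale[OF assms(1)] assms(3) that
    by (simp add: sublinear_on_def)
  moreover have "T (x + y) \<le> T x + T y" if "x \<in> V" "y \<in> V" for x y
    using assms(2)[of x] assms(2)[of y] assms(2)[of "x + y"] subspace_add[OF assms(1)] assms(3) that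
    unfolding sublinear_on_def by metis
  ultimately show ?thesis
    unfolding sublinear_on_def by blast
qed

text \<open>
  Inequalities for the members suffice. For the scaling this is because an inequality for the factor
  \<open>c\<close> can be reversed by using the factor \<open>1 / c\<close>, and the value at \<open>0\<close> is then forced by the factors
  \<open>2\<close> and \<open>1 / 2\<close>.
\<close>

lemma sublinear_on_INF:
  fixes f :: "'i \<Rightarrow> 'a::real_vector \<Rightarrow> real"
  assumes V: "subspace V" and I: "I \<noteq> {}"
    and bdd: "\<And>x. x \<in> V \<Longrightarrow> bdd_below ((\<lambda>i. f i x) ` I)"
    and add: "\<And>x y i k e. x \<in> V \<Longrightarrow> y \<in> V \<Longrightarrow> i \<in> I \<Longrightarrow> k \<in> I \<Longrightarrow> e > 0 \<Longrightarrow>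
                \<exists>l\<in>I. f l (x + y) \<le> f i x + f k y + e"
    and scale: "\<And>x c i. x \<in> V \<Longrightarrow> c > 0 \<Longrightarrow> i \<in> I \<Longrightarrow> \<exists>k\<in>I. f k (c *\<^sub>R x) \<le> c * f i x"
  shows "sublinear_on V (\<lambda>x. INF i\<in>I. f i x)"
proof -
  define g where "g = (\<lambda>x. INF i\<in>I. f i x)"
  have lower: "g x \<le> f i x" if "x \<in> V" "i \<in> I" for x i
    unfolding g_def using that bdd by (intro cINF_lower)
  have approx: "\<exists>i\<in>I. f i x < g x + e" if "x \<in> V" "e > 0" for x e
    using cINF_less_iff[OF I bdd[OF that(1)], of "g x + e"] that(2) unfolding g_def by simp
  have g_add: "g (x + y) \<le> g x + g y" if xy: "x \<in> V" "y \<in> V" for x y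
  proof (rule field_le_epsilon)
    fix e :: real assume e: "e > 0"
    obtain i where i: "i \<in> I" "f i x < g x + e/3"
      using approx[OF xy(1), of "e/3"] e by auto
    obtain k where k: "k \<in> I" "f k y < g y + e/3"
      using approx[OF xy(2), of "e/3"] e by auto
    obtain l where l: "l \<in> I" "f l (x + y) \<le> f i x + f k y + e/3"
      using add[OF xy i(1) k(1), of "e/3"] e by auto
    have "g (x + y) \<le> f l (x + y)"
      using lower l(1) V xy by (simp add: subspace_add)
    then show "g (x + y) \<le> g x + g y + e"
      using i(2) k(2) l(2) by linarith
  qed
  have g_scale_le: "g (c *\<^sub>R x) \<le> c * g x" if x: "x \<in> V" and c: "c > 0" for x c
  proof -
    have "g (c *\<^sub>R x) / c \<le> f i x" if i: "i \<in> I" for i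
    proof -
      obtain k where k: "k \<in> I" "f k (c *\<^sub>R x) \<le> c * f i x"
        using scale[OF x c i] by auto
      have "g (c *\<^sub>R x) \<le> f k (c *\<^sub>R x)"
        using lower k(1) V x by (simp add: subspace_scale)
      then show ?thesis
        using k(2) c by (simp add: field_simps)
    qed
    then have "g (c *\<^sub>R x) / c \<le> g x"
      unfolding g_def by (intro cINF_greatest[OF I])
    then show ?thesis
      using c by (simp add: field_simps)
  qed
  have g_scale: "g (c *\<^sub>R x) = c * g x" if x: "x \<in> V" and c: "c > 0" for x c
  proof (rule antisym)
    have "g ((1/c) *\<^sub>R (c *\<^sub>R x)) \<le> (1/c) * g (c *\<^sub>R x)"
      using x c V by (intro g_scale_le) (auto simp: subspace_scale)
    then show "c * g x \<le> g (c *\<^sub>R x)"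
      using c by (simp add: field_simps)
  qed (rule g_scale_le[OF x c])
  have "g 0 = 0"
    using g_scale[OF subspace_0[OF V], of 2] by simp
  then show ?thesis
    using g_add g_scale unfolding sublinear_on_def g_def[symmetric] by blast
qed

section \<open>Lowering a sublinear functional along a midpoint-convex set\<close>

text \<open>
  The error is halved with each step. A weight \<open>t \<le> 1/2\<close> puts the point halfway between \<open>b\<close> and
  the combination with weight \<open>2 * t\<close>; so an approximation of the latter followed by one use of the midpoint
  hypothesis gives the result, and the case \<open>t \<ge> 1/2\<close> is symmetric. The recursion ends with \<open>a\<close> as
  a crude approximation of every combination.
\<close>

lemma approximate_convex_combination_power:
  assumes S: "sublinear_on V S" and V: "subspace V" and A: "A \<subseteq> V"
    and mid: "\<And>a b. a \<in> A \<Longrightarrow> b \<in> A \<Longrightarrow> \<exists>c\<in>A. S (c - (1/2) *\<^sub>R a - (1/2) *\<^sub>R b) \<le> 0"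
    and ab: "a \<in> A" "b \<in> A" and t: "0 \<le> t" "t \<le> 1"
  shows "\<exists>c\<in>A. S (c - t *\<^sub>R a - (1 - t) *\<^sub>R b) \<le> max 0 (S (a - b)) / 2 ^ k"
  using t
proof (induction k arbitrary: t)
  case 0
  have "a - t *\<^sub>R a - (1 - t) *\<^sub>R b = (1 - t) *\<^sub>R (a - b)"
    by (simp add: algebra_simps)
  moreover have "a - b \<in> V"
    using ab A V by (auto intro: subspace_diff)
  ultimately have "S (a - t *\<^sub>R a - (1 - t) *\<^sub>R b) = (1 - t) * S (a - b)"
    using sublinear_on_scale_nonneg[OF S] 0 by simp
  also have "\<dots> \<le> (1 - t) * max 0 (S (a - b))"
    using 0 by (intro mult_left_mono) auto
  also have "\<dots> \<le> 1 * max 0 (S (a - b))"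
    using 0 by (intro mult_right_mono) auto
  finally show ?case
    using ab(1) by auto
next
  case (Suc k)
  define C where "C = max 0 (S (a - b))"
  have step: "\<exists>c\<in>A. S (c - t *\<^sub>R a - (1 - t) *\<^sub>R b) \<le> C / 2 ^ Suc k"
    if s: "0 \<le> s" "s \<le> 1" and p: "p \<in> A"
      and eq: "t *\<^sub>R a + (1 - t) *\<^sub>R b = (1/2) *\<^sub>R (s *\<^sub>R a + (1 - s) *\<^sub>R b) + (1/2) *\<^sub>R p"
    for s p
  proof -
    obtain d where d: "d \<in> A" "S (d - s *\<^sub>R a - (1 - s) *\<^sub>R b) \<le> C / 2 ^ k"
      using Suc.IH[OF s] unfolding C_def by blast
    obtain c where c: "c \<in> A" "S (c - (1/2) *\<^sub>R d - (1/2) *\<^sub>R p) \<le> 0"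
      using mid[OF d(1) p] by blast
    let ?u = "c - (1/2) *\<^sub>R d - (1/2) *\<^sub>R p" and ?v = "d - s *\<^sub>R a - (1 - s) *\<^sub>R b"
    have inV: "?u \<in> V" "?v \<in> V"
      using A V ab c(1) d(1) p by (auto intro!: subspace_diff subspace_scale)
    have "c - t *\<^sub>R a - (1 - t) *\<^sub>R b = c - (t *\<^sub>R a + (1 - t) *\<^sub>R b)"
      by (simp add: algebra_simps)
    also have "\<dots> = ?u + (1/2) *\<^sub>R ?v"
      unfolding eq by (simp add: algebra_simps)
    finally have "S (c - t *\<^sub>R a - (1 - t) *\<^sub>R b) = S (?u + (1/2) *\<^sub>R ?v)"
      by (rule arg_cong)
    also have "\<dots> \<le> S ?u + S ((1/2) *\<^sub>R ?v)"
      using S inV V unfolding sublinear_on_def by (meson subspace_scale)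
    also have "S ((1/2) *\<^sub>R ?v) = (1/2) * S ?v"
      using inV by (intro sublinear_on_scale_nonneg[OF S]) auto
    finally have "S (c - t *\<^sub>R a - (1 - t) *\<^sub>R b) \<le> C / 2 ^ Suc k"
      using c(2) d(2) by simp
    then show ?thesis
      using c(1) by blast
  qed
  show ?case
  proof (cases "t \<le> 1/2")
    case True
    have "t *\<^sub>R a + (1 - t) *\<^sub>R b = t *\<^sub>R a + ((1/2 - t) *\<^sub>R b + (1/2) *\<^sub>R b)"
      by (simp flip: scaleR_add_left)
    also have "\<dots> = (1/2) *\<^sub>R ((2*t) *\<^sub>R a + (1 - 2*t) *\<^sub>R b) + (1/2) *\<^sub>R b"
      by (simp add: algebra_simps)
    finally show ?thesis
      using step[of "2*t" b] True Suc.prems ab unfolding C_def by auto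
  next
    case False
    have "t *\<^sub>R a + (1 - t) *\<^sub>R b = ((t - 1/2) *\<^sub>R a + (1/2) *\<^sub>R a) + (1 - t) *\<^sub>R b"
      by (simp flip: scaleR_add_left)
    also have "\<dots> = (1/2) *\<^sub>R ((2*t - 1) *\<^sub>R a + (1 - (2*t - 1)) *\<^sub>R b) + (1/2) *\<^sub>R a"
      by (simp add: algebra_simps)
    finally show ?thesis
      using step[of "2*t - 1" a] False Suc.prems ab unfolding C_def by auto
  qed
qed

lemma approximate_convex_combination:
  assumes "sublinear_on V S" "subspace V" "A \<subseteq> V"
    and "\<And>a b. a \<in> A \<Longrightarrow> b \<in> A \<Longrightarrow> \<exists>c\<in>A. S (c - (1/2) *\<^sub>R a - (1/2) *\<^sub>R b) \<le> 0"
    and "a \<in> A" "b \<in> A" "0 \<le> t" "t \<le> 1" and e: "e > 0"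
  shows "\<exists>c\<in>A. S (c - t *\<^sub>R a - (1 - t) *\<^sub>R b) \<le> e"
proof -
  define C where "C = max 0 (S (a - b))"
  obtain k where "C / e < 2 ^ k"
    using real_arch_pow[of 2 "C / e"] by auto
  then have "C / 2 ^ k \<le> e"
    using e by (simp add: field_simps)
  then show ?thesis
    using approximate_convex_combination_power[OF assms(1-8), of k] unfolding C_def by force
qed

text \<open>
  Any linear functional below the \<open>T\<close> obtained here lies between \<open>b\<close> and \<open>S\<close> on \<open>A\<close>. This reduces a lower
  bound on \<open>A\<close> to an upper bound, the only kind that the Hahn--Banach theorem deals with.
\<close>

lemma lower_sublinear_functional:
  assumes S: "sublinear_on V S" and V: "subspace V" and A: "A \<subseteq> V" "A \<noteq> {}"
    and mid: "\<And>a b. a \<in> A \<Longrightarrow> b \<in> A \<Longrightarrow> \<exists>c\<in>A. S (c - (1/2) *\<^sub>R a - (1/2) *\<^sub>R b) \<le> 0"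
    and b: "\<And>a. a \<in> A \<Longrightarrow> b \<le> S a"
  shows "\<exists>T. sublinear_on V T \<and> (\<forall>x\<in>V. T x \<le> S x) \<and> (\<forall>a\<in>A. T (- a) \<le> - b)"
proof -
  define I where "I = A \<times> {0::real..}"
  define f where "f = (\<lambda>(a, t) x. S (x + t *\<^sub>R a) - t * b)"
  define T where "T = (\<lambda>x. INF i\<in>I. f i x)"
  have S_add: "S (x + y) \<le> S x + S y" if "x \<in> V" "y \<in> V" for x y
    using S that by (auto simp: sublinear_on_def)
  have S_scale: "S (c *\<^sub>R x) = c * S x" if "x \<in> V" "c \<ge> 0" for x c
    using sublinear_on_scale_nonneg[OF S] that by blast
  have I_ne: "I \<noteq> {}"
    using A(2) unfolding I_def by auto
  have bdd: "bdd_below ((\<lambda>i. f i x) ` I)" if x: "x \<in> V" for x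
  proof (rule bdd_belowI2)
    fix i assume "i \<in> I"
    then obtain a t where i: "i = (a, t)" and a: "a \<in> A" and t: "t \<ge> 0"
      unfolding I_def by auto
    have inV: "a \<in> V" "- x \<in> V" "x + t *\<^sub>R a \<in> V"
      using A a x V by (auto intro: subspace_add subspace_scale subspace_neg)
    have "t * b \<le> t * S a"
      using b[OF a] t by (rule mult_left_mono)
    also have "\<dots> = S ((x + t *\<^sub>R a) + (- x))"
      using S_scale[OF inV(1) t] by simp
    also have "\<dots> \<le> S (x + t *\<^sub>R a) + S (- x)"
      using S_add inV by blast
    finally show "- S (- x) \<le> f i x"
      unfolding f_def i by simp
  qed
  have "sublinear_on V T"
    unfolding T_def
  proof (rule sublinear_on_INF[OF V I_ne bdd])
    fix x y i k and e :: real
    assume x: "x \<in> V" and y: "y \<in> V" and ik: "i \<in> I" "k \<in> I" and e: "e > 0"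
    obtain p s q t where i: "i = (p, s)" and k: "k = (q, t)"
      and pq: "p \<in> A" "q \<in> A" and st: "s \<ge> 0" "t \<ge> 0"
      using ik unfolding I_def by auto
    show "\<exists>l\<in>I. f l (x + y) \<le> f i x + f k y + e"
    proof (cases "s + t = 0")
      case True
      then have "s = 0" "t = 0"
        using st by auto
      then have "f i (x + y) \<le> f i x + f k y"
        using S_add[OF x y] unfolding f_def i k by simp
      then show ?thesis
        using ik(1) e by (intro bexI[of _ i]) auto
    next
      case False
      define r where "r = s + t"
      have r: "r > 0"
        using False st unfolding r_def by auto
      have w: "r * (s / r) = s" "r * (1 - s / r) = t"
        using r unfolding r_def by (auto simp: field_simps)
      \<comment> \<open>Multiplied by \<open>r\<close>, the weights of the combination below become \<open>s\<close> and \<open>t\<close> and its error \<open>e\<close>.\<close>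
      have "0 \<le> s / r" "s / r \<le> 1"
        using r st unfolding r_def by auto
      then obtain c where c: "c \<in> A"
          and c_le: "S (c - (s / r) *\<^sub>R p - (1 - s / r) *\<^sub>R q) \<le> e / r"
        using approximate_convex_combination[OF S V A(1) mid pq, of "s / r" "e / r"] e r by auto
      let ?d = "c - (s / r) *\<^sub>R p - (1 - s / r) *\<^sub>R q"
      have inV: "x + s *\<^sub>R p \<in> V" "y + t *\<^sub>R q \<in> V" "?d \<in> V"
        using A(1) V x y pq c by (auto intro!: subspace_add subspace_diff subspace_scale)
      have rd: "r *\<^sub>R ?d = r *\<^sub>R c - s *\<^sub>R p - t *\<^sub>R q"
        by (simp only: scaleR_diff_right scaleR_scaleR w)
      have "S (x + y + r *\<^sub>R c) = S ((x + s *\<^sub>R p) + (y + t *\<^sub>R q) + r *\<^sub>R ?d)"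
        unfolding rd by (simp add: algebra_simps)
      also have "\<dots> \<le> S ((x + s *\<^sub>R p) + (y + t *\<^sub>R q)) + S (r *\<^sub>R ?d)"
        using inV V by (intro S_add) (auto intro: subspace_add subspace_scale)
      also have "\<dots> \<le> S (x + s *\<^sub>R p) + S (y + t *\<^sub>R q) + r * S ?d"
        using S_add[OF inV(1,2)] S_scale[OF inV(3), of r] r by simp
      also have "r * S ?d \<le> e"
        using c_le r by (simp add: field_simps)
      finally have "f (c, r) (x + y) \<le> f i x + f k y + e"
        unfolding f_def i k r_def by (simp add: algebra_simps)
      then show ?thesis
        using c r unfolding I_def by (intro bexI[of _ "(c, r)"]) auto
    qed
  next
    fix x c i
    assume x: "x \<in> V" and c: "c > (0::real)" and "i \<in> I"
    then obtain a t where i: "i = (a, t)" and a: "a \<in> A" and t: "t \<ge> 0"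
      unfolding I_def by auto
    have "x + t *\<^sub>R a \<in> V"
      using A a x V by (auto intro: subspace_add subspace_scale)
    then have "S (c *\<^sub>R (x + t *\<^sub>R a)) = c * S (x + t *\<^sub>R a)"
      using S_scale c by simp
    then have "f (a, c * t) (c *\<^sub>R x) = c * f i x"
      unfolding f_def i by (simp add: algebra_simps)
    then show "\<exists>k\<in>I. f k (c *\<^sub>R x) \<le> c * f i x"
      using a c t unfolding I_def by (intro bexI[of _ "(a, c * t)"]) auto
  qed
  moreover have "T x \<le> S x" if x: "x \<in> V" for x
  proof -
    obtain a where "a \<in> A"
      using A(2) by blast
    then have "T x \<le> f (a, 0) x"
      unfolding T_def using bdd[OF x] by (intro cINF_lower) (auto simp: I_def)
    then show ?thesis
      unfolding f_def by simp
  qed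
  moreover have "T (- a) \<le> - b" if a: "a \<in> A" for a
  proof -
    have "- a \<in> V"
      using a A(1) V by (auto intro: subspace_neg)
    from bdd[OF this] have "T (- a) \<le> f (a, 1) (- a)"
      unfolding T_def using a by (intro cINF_lower) (auto simp: I_def)
    then show ?thesis
      using S unfolding f_def by (simp add: sublinear_on_def)
  qed
  ultimately show ?thesis
    by blast
qed

section \<open>The Hahn--Banach theorem\<close>

lemma linear_functional_on_if_minus_le:
  assumes T: "sublinear_on V T" and V: "subspace V"
    and le: "\<And>y. y \<in> V \<Longrightarrow> T (- y) \<le> - T y"
  shows "linear_functional_on V T"
proof -
  have T_add: "T (x + y) \<le> T x + T y" if "x \<in> V" "y \<in> V" for x y
    using T that by (auto simp: sublinear_on_def)
  have T_neg: "T (- y) = - T y" if "y \<in> V" for y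
    using le[OF that] sublinear_on_minus_le[OF T V that] by simp
  have "T (x + y) = T x + T y" if xy: "x \<in> V" "y \<in> V" for x y
  proof (rule antisym)
    have "T ((x + y) + (- y)) \<le> T (x + y) + T (- y)"
      using xy V by (intro T_add) (auto intro: subspace_add subspace_neg)
    then show "T x + T y \<le> T (x + y)"
      using T_neg[OF xy(2)] by simp
  qed (rule T_add[OF xy])
  moreover have "T (c *\<^sub>R x) = c * T x" if x: "x \<in> V" for x c
  proof (cases "c \<ge> 0")
    case True
    then show ?thesis
      using sublinear_on_scale_nonneg[OF T x] by simp
  next
    case False
    then have "T ((- c) *\<^sub>R x) = (- c) * T x"
      by (intro sublinear_on_scale_nonneg[OF T x]) auto
    then show ?thesis
      using T_neg[of "c *\<^sub>R x"] V x by (simp add: subspace_scale)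
  qed
  ultimately show ?thesis
    unfolding linear_functional_on_def by blast
qed

lemma minimal_sublinear_functional:
  assumes S: "sublinear_on V S" and V: "subspace V"
  shows "\<exists>T. sublinear_on V T \<and> (\<forall>x\<in>V. T x \<le> S x) \<and>
             (\<forall>U. sublinear_on V U \<longrightarrow> (\<forall>x\<in>V. U x \<le> T x) \<longrightarrow> (\<forall>x\<in>V. U x = T x))"
proof -
  \<comment> \<open>Fixing the values outside \<open>V\<close> makes the pointwise order on \<open>V\<close> antisymmetric.\<close>
  define F where "F = {T. sublinear_on V T \<and> (\<forall>x\<in>V. T x \<le> S x) \<and> (\<forall>x. x \<notin> V \<longrightarrow> T x = (0::real))}"
  define R where "R = relation_of (\<lambda>T U. U \<le> T) F"
  have restrict: "(\<lambda>x. if x \<in> V then U x else 0) \<in> F"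
    if "sublinear_on V U" "\<forall>x\<in>V. U x \<le> S x" for U
    using that sublinear_on_cong[OF V, of U "\<lambda>x. if x \<in> V then U x else 0"]
    unfolding F_def by auto
  have "\<exists>U\<in>F. \<forall>T\<in>C. U \<le> T" if C: "C \<in> Chains R" for C
  proof (cases "C = {}")
    case True
    then show ?thesis
      using restrict[OF S] by auto
  next
    case False
    have CF: "C \<subseteq> F"
      using C unfolding Chains_def R_def relation_of_def by auto
    have total: "T \<le> U \<or> U \<le> T" if "T \<in> C" "U \<in> C" for T U
      using C that unfolding Chains_def R_def relation_of_def by auto
    define U where "U = (\<lambda>x. INF T\<in>C. T x)"
    have bdd: "bdd_below ((\<lambda>T. T x) ` C)" if x: "x \<in> V" for x
    proof (rule bdd_belowI2)
      fix T assume "T \<in> C"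
      then have T: "sublinear_on V T" "T (- x) \<le> S (- x)"
        using CF x V unfolding F_def by (auto intro: subspace_neg)
      show "- S (- x) \<le> T x"
        using sublinear_on_minus_le[OF T(1) V x] T(2) by linarith
    qed
    have "sublinear_on V U"
      unfolding U_def
    proof (rule sublinear_on_INF[OF V False bdd])
      fix x y T T' and e :: real
      assume xy: "x \<in> V" "y \<in> V" and TT: "T \<in> C" "T' \<in> C" and e: "e > 0"
      obtain W where W: "W \<in> C" "W \<le> T" "W \<le> T'"
        using total[OF TT] TT by blast
      then have "W (x + y) \<le> W x + W y"
        using CF xy unfolding F_def sublinear_on_def by auto
      then have "W (x + y) \<le> T x + T' y + e"
        using le_funD[OF W(2), of x] le_funD[OF W(3), of y] e by linarith
      then show "\<exists>W\<in>C. W (x + y) \<le> T x + T' y + e"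
        using W(1) by blast
    next
      fix x and c :: real and T assume x: "x \<in> V" and c: "c > 0" and T: "T \<in> C"
      then have "T (c *\<^sub>R x) = c * T x"
        using CF unfolding F_def sublinear_on_def by auto
      then show "\<exists>W\<in>C. W (c *\<^sub>R x) \<le> c * T x"
        using T by (intro bexI[of _ T]) auto
    qed
    moreover have lower: "U x \<le> T x" if "x \<in> V" "T \<in> C" for x T
      unfolding U_def using bdd[OF that(1)] that(2) by (rule cINF_lower)
    moreover have "U x \<le> S x" if x: "x \<in> V" for x
    proof -
      obtain T where T: "T \<in> C"
        using False by blast
      then have "T x \<le> S x"
        using CF x unfolding F_def by auto
      then show ?thesis
        using lower[OF x T] by linarith
    qed
    ultimately have "(\<lambda>x. if x \<in> V then U x else 0) \<in> F"
      by (intro restrict) auto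
    moreover have "(\<lambda>x. if x \<in> V then U x else 0) \<le> T" if "T \<in> C" for T
      using that CF lower unfolding F_def by (auto simp: le_fun_def)
    ultimately show ?thesis
      by blast
  qed
  moreover have "partial_order_on F R"
    unfolding R_def by (intro partial_order_on_relation_ofI) auto
  ultimately obtain T where T: "T \<in> F" and min: "\<And>U. U \<in> F \<Longrightarrow> U \<le> T \<Longrightarrow> U = T"
    using predicate_Zorn[of F "\<lambda>T U. U \<le> T"] unfolding R_def by blast
  have T': "sublinear_on V T" "\<forall>x\<in>V. T x \<le> S x" "\<forall>x. x \<notin> V \<longrightarrow> T x = 0"
    using T unfolding F_def by simp_all
  have "\<forall>U. sublinear_on V U \<longrightarrow> (\<forall>x\<in>V. U x \<le> T x) \<longrightarrow> (\<forall>x\<in>V. U x = T x)"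
  proof (intro allI impI ballI)
    fix U x assume U: "sublinear_on V U" "\<forall>x\<in>V. U x \<le> T x" and x: "x \<in> V"
    have "U y \<le> S y" if "y \<in> V" for y
      using U(2) T'(2) that order_trans[of "U y" "T y" "S y"] by simp
    then have "(\<lambda>x. if x \<in> V then U x else 0) \<in> F"
      using U(1) by (intro restrict) simp_all
    moreover have "(\<lambda>x. if x \<in> V then U x else 0) \<le> T"
      using U(2) T'(3) by (simp add: le_fun_def)
    ultimately have "(\<lambda>x. if x \<in> V then U x else 0) = T"
      by (rule min)
    from fun_cong[OF this, of x] show "U x = T x"
      using x by simp
  qed
  with T'(1,2) show ?thesis
    by (intro exI[of _ T] conjI)
qed

text \<open>
  A minimal sublinear functional cannot be lowered along any \<open>y\<close>, which makes it odd and so linear.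
\<close>

theorem hahn_banach_sublinear:
  assumes S: "sublinear_on V S" and V: "subspace V"
  shows "\<exists>L. linear_functional_on V L \<and> (\<forall>x\<in>V. L x \<le> S x)"
proof -
  obtain T where T: "sublinear_on V T" and TS: "\<forall>x\<in>V. T x \<le> S x"
    and min: "\<And>U. sublinear_on V U \<Longrightarrow> \<forall>x\<in>V. U x \<le> T x \<Longrightarrow> \<forall>x\<in>V. U x = T x"
    using minimal_sublinear_functional[OF S V] by blast
  have "T (- y) \<le> - T y" if y: "y \<in> V" for y
  proof -
    have "y - (1/2) *\<^sub>R y - (1/2) *\<^sub>R y = 0"
      by (simp flip: scaleR_add_left add: diff_diff_eq)
    then have "T (y - (1/2) *\<^sub>R y - (1/2) *\<^sub>R y) \<le> 0"
      using T by (simp add: sublinear_on_def)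
    then obtain U where U: "sublinear_on V U" "\<forall>x\<in>V. U x \<le> T x" "U (- y) \<le> - T y"
      using lower_sublinear_functional[OF T V, of "{y}" "T y"] y by auto
    then show ?thesis
      using min[OF U(1,2)] y V by (simp add: subspace_neg)
  qed
  then have "linear_functional_on V T"
    by (rule linear_functional_on_if_minus_le[OF T V])
  then show ?thesis
    using TS by blast
qed

text \<open>
  The linear functional is taken below the functional \<open>T\<close> of \<open>lower_sublinear_functional\<close>, with the
  infimum itself as the bound \<open>b\<close>. If the infimum is \<open>-\<infinity>\<close> there is no such \<open>b\<close>, but then \<open>L \<le> S\<close>
  alone forces the infimum of \<open>L\<close> to be \<open>-\<infinity>\<close> too.
\<close>

theorem hahn_banach_lagrange:
  assumes S: "sublinear_on V S" and V: "subspace V" and A: "A \<subseteq> V" "A \<noteq> {}"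
    and mid: "\<And>a b. a \<in> A \<Longrightarrow> b \<in> A \<Longrightarrow> \<exists>c\<in>A. S (c - (1/2) *\<^sub>R a - (1/2) *\<^sub>R b) \<le> 0"
  shows "\<exists>L. linear_functional_on V L \<and> (\<forall>x\<in>V. L x \<le> S x) \<and>
             (INF a\<in>A. ereal (L a)) = (INF a\<in>A. ereal (S a))"
proof -
  have INF_le: "(INF a\<in>A. ereal (L a)) \<le> (INF a\<in>A. ereal (S a))" if "\<forall>x\<in>V. L x \<le> S x" for L
    using that A(1) by (intro INF_mono) auto
  obtain a0 where a0: "a0 \<in> A"
    using A(2) by blast
  have upper: "(INF a\<in>A. ereal (S a)) \<le> ereal (S a)" if "a \<in> A" for a
    using that by (rule INF_lower)
  show ?thesis
  proof (cases "INF a\<in>A. ereal (S a)")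
    case (real b)
    have "b \<le> S a" if "a \<in> A" for a
      using upper[OF that] unfolding real by simp
    then obtain T where T: "sublinear_on V T" and TS: "\<forall>x\<in>V. T x \<le> S x"
      and Tb: "\<forall>a\<in>A. T (- a) \<le> - b"
      using lower_sublinear_functional[OF S V A mid, of b] by blast
    obtain L where L: "linear_functional_on V L" and LT: "\<forall>x\<in>V. L x \<le> T x"
      using hahn_banach_sublinear[OF T V] by blast
    have "b \<le> L a" if a: "a \<in> A" for a
    proof -
      have "L ((-1) *\<^sub>R a) = (-1) * L a"
        using L a A(1) unfolding linear_functional_on_def by blast
      moreover have "L (- a) \<le> T (- a)"
        using LT a A(1) V by (auto intro: subspace_neg)
      ultimately show ?thesis
        using Tb a by force
    qed
    then have "ereal b \<le> (INF a\<in>A. ereal (L a))"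
      by (intro INF_greatest) simp
    moreover have LS: "\<forall>x\<in>V. L x \<le> S x"
      using LT TS by (meson order_trans)
    ultimately have "(INF a\<in>A. ereal (L a)) = (INF a\<in>A. ereal (S a))"
      using INF_le[OF LS] unfolding real by (intro antisym)
    then show ?thesis
      using L LS by blast
  next
    case PInf
    then show ?thesis
      using upper[OF a0] by simp
  next
    case MInf
    obtain L where L: "linear_functional_on V L" and LS: "\<forall>x\<in>V. L x \<le> S x"
      using hahn_banach_sublinear[OF S V] by blast
    have "(INF a\<in>A. ereal (L a)) = (INF a\<in>A. ereal (S a))"
      using INF_le[OF LS] unfolding MInf by simp
    then show ?thesis
      using L LS by blast
  qed
qed

section \<open>Finite direct sums\<close>

text \<open>
  With a vector space structure on the \<open>'a\<close>-valued families, the direct sum becomes a subspace of one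
  ambient space, to which the results above apply.
\<close>

instantiation "fun" :: (type, real_vector) real_vector
begin

definition scaleR_fun :: "real \<Rightarrow> ('a \<Rightarrow> 'b) \<Rightarrow> 'a \<Rightarrow> 'b" where
  "scaleR_fun c f = (\<lambda>x. c *\<^sub>R f x)"

instance
  by standard (auto simp: scaleR_fun_def fun_eq_iff scaleR_add_right scaleR_add_left)

end

lemma scaleR_fun_apply [simp]: "(c *\<^sub>R f) x = c *\<^sub>R f x"
  by (simp add: scaleR_fun_def)

text \<open>
  The components outside \<open>M\<close> are set to \<open>0\<close> so that each member is the sum of its components in \<open>M\<close>;
  a linear functional is then determined by its values on the summands.
\<close>

definition direct_sum :: "'i set \<Rightarrow> ('i \<Rightarrow> 'a::real_vector set) \<Rightarrow> ('i \<Rightarrow> 'a) set" where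
  "direct_sum M E = {x. (\<forall>m\<in>M. x m \<in> E m) \<and> (\<forall>m. m \<notin> M \<longrightarrow> x m = 0)}"

lemma subspace_direct_sum:
  assumes "\<And>m. m \<in> M \<Longrightarrow> subspace (E m)"
  shows "subspace (direct_sum M E)"
  using assms unfolding direct_sum_def subspace_def by auto

lemma sublinear_on_direct_sum:
  fixes E :: "'i \<Rightarrow> 'a::real_vector set"
  assumes "\<And>m. m \<in> M \<Longrightarrow> sublinear_on (E m) (S m)"
  shows "sublinear_on (direct_sum M E) (\<lambda>x. \<Sum>m\<in>M. S m (x m))"
  unfolding sublinear_on_def
proof (intro conjI ballI allI impI)
  show "(\<Sum>m\<in>M. S m ((0 :: 'i \<Rightarrow> 'a) m)) = 0"
    using assms by (intro sum.neutral) (auto simp: sublinear_on_def)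
next
  fix x and c :: real assume "x \<in> direct_sum M E" "c > 0"
  then show "(\<Sum>m\<in>M. S m ((c *\<^sub>R x) m)) = c * (\<Sum>m\<in>M. S m (x m))"
    using assms unfolding sum_distrib_left
    by (intro sum.cong) (auto simp: sublinear_on_def direct_sum_def)
next
  fix x y assume "x \<in> direct_sum M E" "y \<in> direct_sum M E"
  then show "(\<Sum>m\<in>M. S m ((x + y) m)) \<le> (\<Sum>m\<in>M. S m (x m)) + (\<Sum>m\<in>M. S m (y m))"
    using assms unfolding sum.distrib[symmetric]
    by (intro sum_mono) (auto simp: sublinear_on_def direct_sum_def)
qed

lemma single_in_direct_sum:
  assumes "\<And>m. m \<in> M \<Longrightarrow> subspace (E m)" "m \<in> M" "x \<in> E m"
  shows "0(m := x) \<in> direct_sum M E"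
  using assms by (auto simp: direct_sum_def subspace_0)

lemma linear_functional_on_sum:
  assumes L: "linear_functional_on V L" and V: "subspace V"
    and "finite M" "\<And>m. m \<in> M \<Longrightarrow> g m \<in> V"
  shows "L (\<Sum>m\<in>M. g m) = (\<Sum>m\<in>M. L (g m))"
  using assms(3,4)
proof (induction M rule: finite_induct)
  case empty
  have "L (0 *\<^sub>R 0) = 0 * L 0"
    using L subspace_0[OF V] unfolding linear_functional_on_def by blast
  then show ?case
    by simp
next
  case (insert m M)
  have "(\<Sum>k\<in>M. g k) \<in> V"
    using insert.prems by (intro subspace_sum[OF V]) auto
  then have "L (g m + (\<Sum>k\<in>M. g k)) = L (g m) + L (\<Sum>k\<in>M. g k)"
    using L insert.prems unfolding linear_functional_on_def by simp
  then show ?case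
    using insert by simp
qed

lemma sum_singles:
  assumes "finite M" "\<And>m. m \<notin> M \<Longrightarrow> x m = 0"
  shows "(\<Sum>m\<in>M. (0 :: 'i \<Rightarrow> 'a::real_vector)(m := x m)) = x"
proof
  fix k
  have "(\<Sum>m\<in>M. (0 :: 'i \<Rightarrow> 'a)(m := x m)) k = (\<Sum>m\<in>M. ((0 :: 'i \<Rightarrow> 'a)(m := x m)) k)"
    using assms(1) by (induction M rule: finite_induct) auto
  also have "\<dots> = (\<Sum>m\<in>M. if m = k then x m else 0)"
    by (intro sum.cong) auto
  also have "\<dots> = x k"
    using assms by (auto simp: sum.delta)
  finally show "(\<Sum>m\<in>M. (0 :: 'i \<Rightarrow> 'a)(m := x m)) k = x k" .
qed

text \<open>
  The \<open>m\<close>-th part of \<open>L\<close> is its restriction to the \<open>m\<close>-th summand. There all terms of the dominating sum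
  except \<open>S m\<close> are evaluated at \<open>0\<close>, where they vanish, so the bound on \<open>L\<close> becomes a bound by \<open>S m\<close>.
\<close>

lemma linear_functional_on_direct_sum_split:
  assumes M: "finite M" and E: "\<And>m. m \<in> M \<Longrightarrow> subspace (E m)"
    and S0: "\<And>m. m \<in> M \<Longrightarrow> S m 0 = (0::real)"
    and L: "linear_functional_on (direct_sum M E) L"
    and LS: "\<And>x. x \<in> direct_sum M E \<Longrightarrow> L x \<le> (\<Sum>m\<in>M. S m (x m))"
  shows "\<exists>l. (\<forall>m\<in>M. linear_functional_on (E m) (l m) \<and> (\<forall>x\<in>E m. l m x \<le> S m x)) \<and>
             (\<forall>x\<in>direct_sum M E. L x = (\<Sum>m\<in>M. l m (x m)))"
proof -
  define l where "l = (\<lambda>m x. L (0(m := x)))"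
  have single: "0(m := x) \<in> direct_sum M E" if "m \<in> M" "x \<in> E m" for m x
    using E that by (rule single_in_direct_sum)
  have "linear_functional_on (E m) (l m)" if m: "m \<in> M" for m
    unfolding linear_functional_on_def
  proof (intro conjI ballI allI)
    fix x y assume xy: "x \<in> E m" "y \<in> E m"
    have "0(m := x + y) = 0(m := x) + 0(m := y)"
      by (auto simp: fun_eq_iff)
    then show "l m (x + y) = l m x + l m y"
      using L single[OF m] xy unfolding linear_functional_on_def l_def by simp
  next
    fix x c assume x: "x \<in> E m"
    have "0(m := c *\<^sub>R x) = c *\<^sub>R (0(m := x))"
      by (auto simp: fun_eq_iff)
    then show "l m (c *\<^sub>R x) = c * l m x"
      using L single[OF m] x unfolding linear_functional_on_def l_def by simp
  qed
  moreover have "l m x \<le> S m x" if m: "m \<in> M" and x: "x \<in> E m" for m x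
  proof -
    have "l m x \<le> (\<Sum>k\<in>M. S k ((0(m := x)) k))"
      unfolding l_def by (rule LS[OF single[OF m x]])
    also have "\<dots> = (\<Sum>k\<in>M. if k = m then S k x else 0)"
      using S0 by (intro sum.cong) auto
    also have "\<dots> = S m x"
      using M m by simp
    finally show ?thesis .
  qed
  moreover have "L x = (\<Sum>m\<in>M. l m (x m))" if x: "x \<in> direct_sum M E" for x
  proof -
    have "L x = L (\<Sum>m\<in>M. 0(m := x m))"
      using sum_singles[OF M, of x] x by (simp add: direct_sum_def)
    also have "\<dots> = (\<Sum>m\<in>M. l m (x m))"
      unfolding l_def using x
      by (intro linear_functional_on_sum[OF L subspace_direct_sum[OF E] M] single)
        (auto simp: direct_sum_def)
    finally show ?thesis .
  qed
  ultimately show ?thesis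
    by blast
qed

section \<open>Several sublinear functionals\<close>

theorem theorem5p1:
  fixes n :: nat
    and E :: "nat \<Rightarrow> 'a::real_vector set"
    and S :: "nat \<Rightarrow> 'a \<Rightarrow> real"
    and Z :: "'z set"
    and j :: "nat \<Rightarrow> 'z \<Rightarrow> 'a"
  assumes "n \<ge> 1"
    and "\<And>m. m \<in> {1..n} \<Longrightarrow> subspace (E m)"
    and "\<And>m. m \<in> {1..n} \<Longrightarrow> sublinear_on (E m) (S m)"
    and "Z \<noteq> {}"
    and "\<And>m. m \<in> {1..n} \<Longrightarrow> j m \<in> Z \<rightarrow> E m"
    and "\<And>z1 z2. z1 \<in> Z \<Longrightarrow> z2 \<in> Z \<Longrightarrow>
           \<exists>z\<in>Z. (\<Sum>m=1..n. S m (j m z - (1/2) *\<^sub>R j m z1 - (1/2) *\<^sub>R j m z2)) \<le> 0"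
  shows "\<exists>L :: nat \<Rightarrow> 'a \<Rightarrow> real.
           (\<forall>m\<in>{1..n}. linear_functional_on (E m) (L m) \<and> (\<forall>x\<in>E m. L m x \<le> S m x)) \<and>
           (INF z\<in>Z. ereal (\<Sum>m=1..n. L m (j m z))) = (INF z\<in>Z. ereal (\<Sum>m=1..n. S m (j m z)))"
  proof -
  define M where "M = {1..n}"
  define V where "V = direct_sum M E"
  define P where "P = (\<lambda>x. \<Sum>m\<in>M. S m (x m))"
  define J where "J = (\<lambda>z m. if m \<in> M then j m z else 0)"
  have V: "subspace V"
    unfolding V_def M_def by (intro subspace_direct_sum assms(2))
  have P: "sublinear_on V P"
    unfolding V_def P_def M_def by (intro sublinear_on_direct_sum assms(3))
  have J: "J ` Z \<subseteq> V"
    using assms(5) unfolding V_def J_def M_def direct_sum_def by (auto simp: Pi_iff)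
  have "\<exists>c\<in>J ` Z. P (c - (1/2) *\<^sub>R a - (1/2) *\<^sub>R b) \<le> 0" if ab: "a \<in> J ` Z" "b \<in> J ` Z" for a b
  proof -
    obtain z1 z2 where z12: "z1 \<in> Z" "z2 \<in> Z" "a = J z1" "b = J z2"
      using ab by blast
    obtain z where z: "z \<in> Z"
      "(\<Sum>m=1..n. S m (j m z - (1/2) *\<^sub>R j m z1 - (1/2) *\<^sub>R j m z2)) \<le> 0"
      using assms(6)[OF z12(1,2)] by blast
    have "P (J z - (1/2) *\<^sub>R a - (1/2) *\<^sub>R b)
        = (\<Sum>m=1..n. S m (j m z - (1/2) *\<^sub>R j m z1 - (1/2) *\<^sub>R j m z2))"
      unfolding P_def J_def M_def z12(3,4) by (intro sum.cong) auto
    then show ?thesis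
      using z by (intro bexI[of _ "J z"]) auto
  qed
  then obtain L where L: "linear_functional_on V L" and LP: "\<forall>x\<in>V. L x \<le> P x"
    and INF_eq: "(INF a\<in>J ` Z. ereal (L a)) = (INF a\<in>J ` Z. ereal (P a))"
    using hahn_banach_lagrange[OF P V J] assms(4) by blast
  have S0: "S m 0 = 0" if "m \<in> M" for m
    using assms(3) that unfolding M_def sublinear_on_def by blast
  obtain l where l: "\<forall>m\<in>M. linear_functional_on (E m) (l m) \<and> (\<forall>x\<in>E m. l m x \<le> S m x)"
    and split: "\<forall>x\<in>V. L x = (\<Sum>m\<in>M. l m (x m))"
    using linear_functional_on_direct_sum_split[of M E S L] assms(2) S0 L LP
    unfolding V_def P_def M_def by blast
  have "P (J z) = (\<Sum>m=1..n. S m (j m z))" for z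
    unfolding P_def J_def M_def by (intro sum.cong) auto
  moreover have "L (J z) = (\<Sum>m=1..n. l m (j m z))" if "z \<in> Z" for z
  proof -
    have "L (J z) = (\<Sum>m\<in>M. l m (J z m))"
      using split J that by blast
    also have "\<dots> = (\<Sum>m=1..n. l m (j m z))"
      unfolding J_def M_def by (intro sum.cong) auto
    finally show ?thesis .
  qed
  moreover have "(INF z\<in>Z. ereal (L (J z))) = (INF z\<in>Z. ereal (P (J z)))"
    using INF_eq by (simp only: image_image)
  ultimately have "(INF z\<in>Z. ereal (\<Sum>m=1..n. l m (j m z)))
      = (INF z\<in>Z. ereal (\<Sum>m=1..n. S m (j m z)))"
    by simp
  then show ?thesis
    using l unfolding M_def by blast
qed

end
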